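(* For the Hermite polynomials $H_n$, there is some constant $K_0>0$ independent of $n$ and $y$ such that, for all $n\ge 1$, $$\left|e^{-y^2/2}H_n(y)\right|\le K_0\sqrt{n!}\,n^{-1/12}e^{-y^2/4}\quad\text{for any }y\in\mathbb{R}.$$
   Context: $H_n(x)=(-1)^n\frac{1}{\phi(x)}\frac{d^n}{dx^n}\phi(x)$, where $\phi(x)=(2\pi)^{-1/2}\exp(-x^2/2)$ is the standard Normal density. *)

theory Defs
  imports "HOL-Probability.Distributions"
begin

definition Hermite :: "nat \<Rightarrow> real \<Rightarrow> real" where
  "Hermite n x = (-1) ^ n * (1 / std_normal_density x) * (deriv ^^ n) std_normal_density x"

end

theory Submission
  imports Defs "HOL-Real_Asymp.Real_Asymp"
begin

text \<open>
  The normalised Hermite function \<open>u y = H\<^sub>n(y) exp (- y\<^sup>2 / 4) / sqrt (n!)\<close> solves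
  \<open>u'' + q u = 0\<close> with \<open>q = N - y\<^sup>2 / 4\<close> and \<open>N = n + 1 / 2\<close>. With \<open>s = sqrt q\<close>, the
  adiabatic energy \<open>s u\<^sup>2 + u'\<^sup>2 / s\<close>, corrected by \<open>g u u'\<close> with \<open>g = s' / s\<^sup>2\<close>, has the
  derivative \<open>g' u u'\<close>. It therefore stays bounded, by Gronwall's inequality, as long as \<open>g\<close> is
  small, which is the case until \<open>q\<close> drops to \<open>N powr (1 / 3)\<close>; there
  \<open>u\<^sup>2 \<le> C N powr (- 1 / 6)\<close>. The remaining interval up to the turning point
  \<open>y = 2 sqrt N\<close> has length at most \<open>2 N powr (- 1 / 6)\<close>, and a second Gronwall estimate with
  frozen \<open>q\<close> loses only a constant factor on it. Beyond the turning point \<open>u\<^sup>2\<close> is convex and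
  tends to \<open>0\<close>, so it decreases.
\<close>

section \<open>Gronwall's inequality and a weighted mean inequality\<close>

lemma gronwall_le:
  fixes f h :: "real \<Rightarrow> real"
  assumes "a \<le> b"
    and f: "\<And>x. a \<le> x \<Longrightarrow> x \<le> b \<Longrightarrow> (f has_real_derivative f' x) (at x)"
    and h: "\<And>x. a \<le> x \<Longrightarrow> x \<le> b \<Longrightarrow> (h has_real_derivative h' x) (at x)"
    and le: "\<And>x. a \<le> x \<Longrightarrow> x \<le> b \<Longrightarrow> f' x \<le> h' x * f x"
  shows "f b \<le> f a * exp (h b - h a)"
proof -
  have "f b * exp (- h b) \<le> f a * exp (- h a)"
  proof (rule DERIV_nonpos_imp_nonincreasing[OF \<open>a \<le> b\<close>])
    fix x assume x: "a \<le> x" "x \<le> b"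
    have "((\<lambda>x. f x * exp (- h x)) has_real_derivative (f' x - h' x * f x) * exp (- h x)) (at x)"
      by (rule derivative_eq_intros f h x refl | simp add: algebra_simps)+
    moreover have "(f' x - h' x * f x) * exp (- h x) \<le> 0"
      using le[OF x] by (simp add: mult_le_0_iff)
    ultimately show "\<exists>y. ((\<lambda>x. f x * exp (- h x)) has_real_derivative y) (at x) \<and> y \<le> 0"
      by blast
  qed
  then have "f b * exp (- h b) * exp (h b) \<le> f a * exp (- h a) * exp (h b)"
    by (rule mult_right_mono) simp
  then show ?thesis
    by (simp add: mult.assoc flip: exp_add)
qed

text \<open>Completing a square. It lets an energy with weights \<open>s\<close> and
  \<open>1 / s\<close> dominate the product \<open>u v\<close>.\<close>

lemma two_abs_mult_le_weighted_squares:
  fixes x y s :: real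
  assumes "s > 0"
  shows "2 * \<bar>x * y\<bar> \<le> s * x\<^sup>2 + y\<^sup>2 / s"
proof -
  have "0 \<le> (s * \<bar>x\<bar> - \<bar>y\<bar>)\<^sup>2 / s"
    using assms by simp
  also have "\<dots> = s * x\<^sup>2 + y\<^sup>2 / s - 2 * \<bar>x * y\<bar>"
    using assms by (simp add: field_simps power2_eq_square abs_mult)
  finally show ?thesis by simp
qed

section \<open>Solutions of the Weber equation\<close>

text \<open>The parameter \<open>N\<close> is written as \<open>t ^ 6\<close>, so that \<open>N powr (1 / 6)\<close> is \<open>t\<close>.\<close>

locale weber_solution =
  fixes t :: real and u v :: "real \<Rightarrow> real"
  assumes t_ge_1: "t \<ge> 1"
    and u_deriv: "\<And>y. (u has_real_derivative v y) (at y)"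
    and v_deriv: "\<And>y. (v has_real_derivative - ((t ^ 6 - y\<^sup>2 / 4) * u y)) (at y)"
begin

text \<open>The condition on \<open>y\<close> keeps \<open>s\<close> above \<open>t\<close>, so the
  correction term is at most a quarter of the energy. The factor 4 is \<open>4 / 3\<close>, from
  passing between the energy and its corrected form, times 3, a crude bound for the Gronwall
  exponential.\<close>

lemma oscillatory_energy_le:
  assumes y: "0 \<le> y" "t\<^sup>2 \<le> t ^ 6 - y\<^sup>2 / 4"
  defines "s \<equiv> \<lambda>y. sqrt (t ^ 6 - y\<^sup>2 / 4)"
  shows "s y * (u y)\<^sup>2 + (v y)\<^sup>2 / s y \<le> 4 * (t ^ 3 * (u 0)\<^sup>2 + (v 0)\<^sup>2 / t ^ 3)"
proof -
  \<comment> \<open>Since \<open>s' = - y / (4 * s)\<close>, this is \<open>- s' / s^2\<close>. The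
    derivative of \<open>E\<close> is \<open>s' * (u^2 - v^2 / s^2)\<close>, and subtracting
    \<open>h * u * v\<close> cancels exactly this, leaving \<open>- h' * u * v\<close>.\<close>
  define h where "h = (\<lambda>y. y / (4 * s y ^ 3))"
  define E where "E = (\<lambda>y. s y * (u y)\<^sup>2 + (v y)\<^sup>2 / s y)"
  define F where "F = (\<lambda>y. E y - h y * (u y * v y))"
  define h' where "h' = (\<lambda>y. 1 / (4 * s y ^ 3) + 3 * y\<^sup>2 / (16 * s y ^ 5))"
  have s_sq: "(s x)\<^sup>2 = t ^ 6 - x\<^sup>2 / 4" and s_ge: "t \<le> s x" if "0 \<le> x" "x \<le> y" for x
  proof -
    have "x\<^sup>2 \<le> y\<^sup>2"
      using that by (simp add: power_mono)
    then have *: "t\<^sup>2 \<le> t ^ 6 - x\<^sup>2 / 4"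
      using y by linarith
    then show "t \<le> s x"
      unfolding s_def by (rule real_le_rsqrt)
    show "(s x)\<^sup>2 = t ^ 6 - x\<^sup>2 / 4"
      using order_trans[OF zero_le_power2 *] by (simp add: s_def)
  qed
  have s_pos: "s x > 0" if "0 \<le> x" "x \<le> y" for x
    using s_ge[OF that] t_ge_1 by linarith
  have h_bounds: "0 \<le> h x" "h x \<le> 1 / 2" if x: "0 \<le> x" "x \<le> y" for x
  proof -
    show "0 \<le> h x"
      using s_pos[OF x] x by (simp add: h_def)
    \<comment> \<open>Nonnegativity of \<open>q\<close> gives \<open>x <= 2 * t ^ 3\<close>, and
      \<open>s x >= t\<close> turns this into \<open>x <= 2 * s x ^ 3\<close>.\<close>
    have "x\<^sup>2 \<le> 4 * t ^ 6"
      using s_sq[OF x] zero_le_power2[of "s x"] by linarith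
    also have "4 * t ^ 6 = (2 * t ^ 3)\<^sup>2"
      by (simp add: power_mult_distrib flip: power_mult)
    finally have "x \<le> 2 * t ^ 3"
      by (rule power2_le_imp_le) (use t_ge_1 in simp)
    also have "\<dots> \<le> 2 * s x ^ 3"
      using s_ge[OF x] t_ge_1 by (simp add: power_mono)
    finally show "h x \<le> 1 / 2"
      using s_pos[OF x] by (simp add: h_def field_simps)
  qed
  have uv_le: "2 * \<bar>u x * v x\<bar> \<le> E x" if "0 \<le> x" "x \<le> y" for x
    unfolding E_def by (rule two_abs_mult_le_weighted_squares[OF s_pos[OF that]])
  have E_le: "E x \<le> 4 / 3 * F x" if x: "0 \<le> x" "x \<le> y" for x
  proof -
    have "h x * (u x * v x) \<le> h x * \<bar>u x * v x\<bar>"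
      using h_bounds[OF x] by (intro mult_left_mono) auto
    also have "\<dots> \<le> 1 / 2 * \<bar>u x * v x\<bar>"
      using h_bounds[OF x] by (intro mult_right_mono) auto
    finally show ?thesis
      using uv_le[OF x] by (simp add: F_def)
  qed
  have s_deriv: "(s has_real_derivative - x / (4 * s x)) (at x)" if x: "0 \<le> x" "x \<le> y" for x
  proof -
    have "t ^ 6 - x\<^sup>2 / 4 > 0"
      using s_pos[OF x] by (simp add: s_def)
    then show ?thesis
      unfolding s_def
      by (auto intro!: derivative_eq_intros simp: field_simps)
  qed
  have h_deriv: "(h has_real_derivative h' x) (at x)" if x: "0 \<le> x" "x \<le> y" for x
    unfolding h_def h'_def using s_pos[OF x]
    by (auto intro!: derivative_eq_intros s_deriv x simp: field_simps power2_eq_square eval_nat_numeral)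
  have v_deriv': "(v has_real_derivative - ((s x)\<^sup>2 * u x)) (at x)" if x: "0 \<le> x" "x \<le> y" for x
    using v_deriv[of x] s_sq[OF x] by simp
  have F_deriv: "(F has_real_derivative - (h' x * (u x * v x))) (at x)" if x: "0 \<le> x" "x \<le> y" for x
    unfolding F_def E_def
    using s_pos[OF x]
    by (auto intro!: derivative_eq_intros u_deriv v_deriv' s_deriv h_deriv x
        simp: h_def h'_def field_simps power2_eq_square eval_nat_numeral)
  \<comment> \<open>As \<open>h' >= 0\<close> and \<open>|u v| <= E / 2 <= F\<close>, the function
    \<open>h\<close> itself serves as Gronwall exponent, and its total growth is at most
    \<open>1 / 2\<close>.\<close>
  have "F y \<le> F 0 * exp (h y - h 0)"
  proof (rule gronwall_le[OF y(1) F_deriv h_deriv])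
    fix x assume x: "0 \<le> x" "x \<le> y"
    have "h' x \<ge> 0"
      using s_pos[OF x] x by (simp add: h'_def)
    moreover have "- (u x * v x) \<le> F x"
      using E_le[OF x] uv_le[OF x] by linarith
    ultimately have "h' x * (- (u x * v x)) \<le> h' x * F x"
      by (rule mult_left_mono[rotated])
    then show "- (h' x * (u x * v x)) \<le> h' x * F x"
      by simp
  qed auto
  moreover have "h 0 = 0"
    by (simp add: h_def)
  moreover have F0: "F 0 = E 0"
    by (simp add: F_def h_def)
  moreover have "E 0 * exp (h y) \<le> E 0 * 3"
  proof (rule mult_left_mono)
    have "exp (h y) \<le> exp 1"
      using h_bounds[OF y(1)] by simp
    then show "exp (h y) \<le> 3"
      using exp_le by linarith
    show "0 \<le> E 0"
      using uv_le[of 0] y by simp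
  qed
  ultimately have "E y \<le> 4 * E 0"
    using E_le[OF y(1)] by simp
  moreover have "s 0 = t ^ 3"
    using t_ge_1 by (simp add: s_def real_sqrt_unique flip: power_mult)
  ultimately show ?thesis
    by (simp add: E_def)
qed

text \<open>Between \<open>y1\<close> and the turning point, \<open>0 <= q <= t^2\<close>. The
  energy with \<open>q\<close> frozen at \<open>t^2\<close> has derivative
  \<open>2 * (t^2 - q) * u * v\<close>, so it grows at rate at most \<open>t\<close>, over a length
  at most \<open>2 / t\<close>. The factor 9 bounds \<open>exp 2\<close>.\<close>

lemma transition_energy_le:
  assumes "0 \<le> y1" "y1 \<le> y" "y \<le> 2 * t ^ 3" and y1: "y1\<^sup>2 / 4 = t ^ 6 - t\<^sup>2"
  shows "t\<^sup>2 * (u y)\<^sup>2 + (v y)\<^sup>2 \<le> 9 * (t\<^sup>2 * (u y1)\<^sup>2 + (v y1)\<^sup>2)"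
proof -
  define S where "S = (\<lambda>y. t\<^sup>2 * (u y)\<^sup>2 + (v y)\<^sup>2)"
  have "S y \<le> S y1 * exp (t * y - t * y1)"
  proof (rule gronwall_le[where h' = "\<lambda>_. t", OF \<open>y1 \<le> y\<close>])
    fix x assume x: "y1 \<le> x" "x \<le> y"
    show "(S has_real_derivative 2 * ((t\<^sup>2 - (t ^ 6 - x\<^sup>2 / 4)) * (u x * v x))) (at x)"
      unfolding S_def
      by (rule derivative_eq_intros u_deriv v_deriv refl | simp add: algebra_simps power2_eq_square)+
    show "((*) t has_real_derivative t) (at x)"
      by (auto intro!: derivative_eq_intros)
    have "y1\<^sup>2 \<le> x\<^sup>2" "x\<^sup>2 \<le> (2 * t ^ 3)\<^sup>2"
      using x assms by (intro power_mono; linarith)+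
    then have q: "0 \<le> t\<^sup>2 - (t ^ 6 - x\<^sup>2 / 4)" "t\<^sup>2 - (t ^ 6 - x\<^sup>2 / 4) \<le> t\<^sup>2"
      using y1 by (auto simp: power_mult_distrib simp flip: power_mult)
    have "(t\<^sup>2 - (t ^ 6 - x\<^sup>2 / 4)) * (u x * v x) \<le> (t\<^sup>2 - (t ^ 6 - x\<^sup>2 / 4)) * \<bar>u x * v x\<bar>"
      by (rule mult_left_mono) (use q in auto)
    also have "\<dots> \<le> t\<^sup>2 * \<bar>u x * v x\<bar>"
      by (rule mult_right_mono) (use q in auto)
    finally have "2 * ((t\<^sup>2 - (t ^ 6 - x\<^sup>2 / 4)) * (u x * v x)) \<le> t\<^sup>2 * (2 * \<bar>u x * v x\<bar>)"
      by simp
    also have "\<dots> \<le> t\<^sup>2 * (t * (u x)\<^sup>2 + (v x)\<^sup>2 / t)"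
      using t_ge_1 by (intro mult_left_mono two_abs_mult_le_weighted_squares) auto
    also have "\<dots> = t * S x"
      using t_ge_1 by (simp add: S_def field_simps power2_eq_square)
    finally show "2 * ((t\<^sup>2 - (t ^ 6 - x\<^sup>2 / 4)) * (u x * v x)) \<le> t * S x" .
  qed
  moreover have "exp (t * y - t * y1) \<le> 9"
  proof -
    \<comment> \<open>The length of the interval is read off from the difference of squares
      \<open>4 * t ^ 6 - y1^2 = 4 * t^2\<close>.\<close>
    have "(2 * t ^ 3 - y1) * (2 * t ^ 3) \<le> (2 * t ^ 3 - y1) * (2 * t ^ 3 + y1)"
      using assms by (intro mult_left_mono) auto
    also have "\<dots> = 4 * t\<^sup>2"
      using y1 by (simp add: algebra_simps power2_eq_square eval_nat_numeral)
    finally have "(t * (2 * t ^ 3 - y1)) * (2 * t\<^sup>2) \<le> 2 * (2 * t\<^sup>2)"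
      by (simp add: algebra_simps power2_eq_square eval_nat_numeral)
    then have "t * (2 * t ^ 3 - y1) \<le> 2"
      by (rule mult_right_le_imp_le) (use t_ge_1 in auto)
    moreover have "t * (y - y1) \<le> t * (2 * t ^ 3 - y1)"
      using assms t_ge_1 by (intro mult_left_mono) auto
    ultimately have "exp (t * y - t * y1) \<le> exp (1 + 1)"
      by (simp add: algebra_simps)
    also have "\<dots> = exp 1 * exp 1"
      by (rule exp_add)
    also have "\<dots> \<le> 3 * (3 :: real)"
      by (intro mult_mono exp_le) auto
    finally show ?thesis by simp
  qed
  then have "S y1 * exp (t * y - t * y1) \<le> S y1 * 9"
    by (intro mult_left_mono) (auto simp: S_def)
  ultimately show ?thesis
    by (simp add: S_def)
qed

text \<open>Here \<open>(u v)' = v^2 - q u^2 >= 0\<close>, so \<open>u v\<close>, half the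
  derivative of \<open>u^2\<close>, is nondecreasing. Were it positive somewhere, \<open>u^2\<close>
  would stay above a positive value from there on, contradicting the limit 0.\<close>

lemma square_decreasing_beyond_turning_point:
  assumes lim: "(u \<longlongrightarrow> 0) at_top" and "2 * t ^ 3 \<le> y"
  shows "(u y)\<^sup>2 \<le> (u (2 * t ^ 3))\<^sup>2"
proof (rule DERIV_nonpos_imp_nonincreasing[OF \<open>2 * t ^ 3 \<le> y\<close>])
  have sq_deriv: "((\<lambda>x. (u x)\<^sup>2) has_real_derivative 2 * (u x * v x)) (at x)" for x
    by (rule derivative_eq_intros u_deriv refl | simp)+
  have uv_mono: "u x * v x \<le> u z * v z" if "2 * t ^ 3 \<le> x" "x \<le> z" for x z
  proof (rule DERIV_nonneg_imp_nondecreasing[OF \<open>x \<le> z\<close>])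
    fix w assume "x \<le> w" "w \<le> z"
    have "((\<lambda>x. u x * v x) has_real_derivative (v w)\<^sup>2 + (w\<^sup>2 / 4 - t ^ 6) * (u w)\<^sup>2) (at w)"
      by (rule derivative_eq_intros u_deriv v_deriv refl | simp add: algebra_simps power2_eq_square)+
    moreover have "(2 * t ^ 3)\<^sup>2 \<le> w\<^sup>2"
      using that \<open>x \<le> w\<close> t_ge_1 by (intro power_mono) auto
    then have "w\<^sup>2 / 4 - t ^ 6 \<ge> 0"
      by (simp add: power_mult_distrib flip: power_mult)
    ultimately show "\<exists>d. ((\<lambda>x. u x * v x) has_real_derivative d) (at w) \<and> 0 \<le> d"
      by fastforce
  qed
  fix x assume x: "2 * t ^ 3 \<le> x"
  have "u x * v x \<le> 0"
  proof (rule ccontr)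
    assume pos: "\<not> u x * v x \<le> 0"
    have "(u x)\<^sup>2 \<le> (u z)\<^sup>2" if "x \<le> z" for z
    proof (rule DERIV_nonneg_imp_nondecreasing[OF that])
      fix w assume "x \<le> w"
      then show "\<exists>d. ((\<lambda>x. (u x)\<^sup>2) has_real_derivative d) (at w) \<and> 0 \<le> d"
        using sq_deriv[of w] uv_mono[OF x, of w] pos by fastforce
    qed
    then have "\<forall>\<^sub>F z in at_top. (u x)\<^sup>2 \<le> (u z)\<^sup>2"
      using eventually_at_top_linorder by blast
    moreover have "((\<lambda>z. (u z)\<^sup>2) \<longlongrightarrow> 0) at_top"
      using tendsto_power[OF lim, of 2] by simp
    ultimately have "(u x)\<^sup>2 \<le> 0"
      by (intro tendsto_lowerbound) auto
    then show False
      using pos by simp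
  qed
  then show "\<exists>d. ((\<lambda>x. (u x)\<^sup>2) has_real_derivative d) (at x) \<and> d \<le> 0"
    using sq_deriv[of x] by fastforce
qed

text \<open>Chains the estimates of the three regions; 36 is the product of the factors 4 and 9 lost
  in the first two.\<close>

lemma square_le:
  assumes lim: "(u \<longlongrightarrow> 0) at_top" and "y \<ge> 0"
    and init: "t ^ 3 * (u 0)\<^sup>2 + (v 0)\<^sup>2 / t ^ 3 \<le> A"
  shows "(u y)\<^sup>2 \<le> 36 * A / t"
proof -
  have A: "A \<ge> 0"
    by (rule order_trans[OF _ init]) (use t_ge_1 in auto)
  define y1 where "y1 = 2 * sqrt (t ^ 6 - t\<^sup>2)"
  have "t\<^sup>2 \<le> t ^ 6"
    using t_ge_1 by (intro power_increasing) auto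
  then have y1: "y1 \<ge> 0" "y1\<^sup>2 / 4 = t ^ 6 - t\<^sup>2"
    by (auto simp: y1_def power_mult_distrib)
  have mono: "x \<le> z \<longleftrightarrow> x\<^sup>2 \<le> z\<^sup>2" if "x \<ge> 0" "z \<ge> 0" for x z :: real
    using that by (simp add: power2_le_iff_abs_le)
  have y1_le: "y1 \<le> 2 * t ^ 3"
    using y1 t_ge_1 zero_le_power2[of t]
    by (subst mono) (auto simp: power_mult_distrib simp flip: power_mult)
  consider "y \<le> y1" | "y1 \<le> y" "y \<le> 2 * t ^ 3" | "2 * t ^ 3 \<le> y"
    by linarith
  moreover have oscillatory: ?thesis if "y \<le> y1"
  proof -
    define s where "s = sqrt (t ^ 6 - y\<^sup>2 / 4)"
    have q: "t\<^sup>2 \<le> t ^ 6 - y\<^sup>2 / 4"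
      using that mono[OF \<open>y \<ge> 0\<close> y1(1)] y1(2) by linarith
    have s: "t \<le> s"
      unfolding s_def using q by (rule real_le_rsqrt)
    have "t * (u y)\<^sup>2 \<le> s * (u y)\<^sup>2"
      using s by (intro mult_right_mono) auto
    also have "\<dots> \<le> s * (u y)\<^sup>2 + (v y)\<^sup>2 / s"
      using s t_ge_1 by simp
    also have "\<dots> \<le> 4 * A"
      using oscillatory_energy_le[OF \<open>y \<ge> 0\<close> q] init by (simp add: s_def)
    finally have "t * (u y)\<^sup>2 \<le> 36 * A"
      using A by linarith
    then show ?thesis
      using t_ge_1 by (simp add: field_simps)
  qed
  moreover have transition: "(u z)\<^sup>2 \<le> 36 * A / t" if z: "y1 \<le> z" "z \<le> 2 * t ^ 3" for z
  proof -
    have "sqrt (t ^ 6 - y1\<^sup>2 / 4) = t"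
      unfolding y1(2) using t_ge_1 by simp
    then have "t * (u y1)\<^sup>2 + (v y1)\<^sup>2 / t \<le> 4 * A"
      using oscillatory_energy_le[OF y1(1)] y1(2) init by simp
    then have "t * (t * (u y1)\<^sup>2 + (v y1)\<^sup>2 / t) \<le> t * (4 * A)"
      using t_ge_1 by (intro mult_left_mono) auto
    moreover have "t * (t * (u y1)\<^sup>2 + (v y1)\<^sup>2 / t) = t\<^sup>2 * (u y1)\<^sup>2 + (v y1)\<^sup>2"
      using t_ge_1 by (simp add: field_simps power2_eq_square)
    ultimately have y1_energy: "t\<^sup>2 * (u y1)\<^sup>2 + (v y1)\<^sup>2 \<le> 4 * (A * t)"
      by (simp add: mult_ac)
    have "t\<^sup>2 * (u z)\<^sup>2 + (v z)\<^sup>2 \<le> 9 * (t\<^sup>2 * (u y1)\<^sup>2 + (v y1)\<^sup>2)"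
      using z y1 by (intro transition_energy_le) auto
    also have "\<dots> \<le> 9 * (4 * (A * t))"
      using y1_energy by (rule mult_left_mono) simp
    finally have "t\<^sup>2 * (u z)\<^sup>2 \<le> 36 * (A * t)"
      using zero_le_power2[of "v z"] by linarith
    then show ?thesis
      using t_ge_1 by (simp add: field_simps power2_eq_square)
  qed
  moreover have ?thesis if "2 * t ^ 3 \<le> y"
    using square_decreasing_beyond_turning_point[OF lim that] transition[of "2 * t ^ 3"] y1_le
    by simp
  ultimately show ?thesis
    by blast
qed

end

section \<open>Hermite polynomials\<close>

text \<open>The probabilists' Hermite polynomials, given by their three-term recurrence.\<close>

fun hermite_poly :: "nat \<Rightarrow> real \<Rightarrow> real" where
  "hermite_poly 0 x = 1"
| "hermite_poly (Suc 0) x = x"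
| "hermite_poly (Suc (Suc n)) x = x * hermite_poly (Suc n) x - real (Suc n) * hermite_poly n x"

text \<open>Covers both recursive cases at once: at \<open>n = 0\<close> the truncated index
  \<open>n - 1\<close> is harmless because its coefficient vanishes.\<close>

lemma hermite_poly_Suc:
  "hermite_poly (Suc n) x = x * hermite_poly n x - real n * hermite_poly (n - 1) x"
  by (cases n) auto

lemma hermite_poly_deriv:
  "(hermite_poly n has_real_derivative real n * hermite_poly (n - 1) x) (at x)"
proof (induction n x rule: hermite_poly.induct)
  case (3 n x)
  have "((\<lambda>x. x * hermite_poly (Suc n) x - real (Suc n) * hermite_poly n x) has_real_derivative
      hermite_poly (Suc n) x + x * (real (Suc n) * hermite_poly n x)
        - real (Suc n) * (real n * hermite_poly (n - 1) x)) (at x)"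
    by (rule derivative_eq_intros 3 refl | simp)+
  moreover have "hermite_poly (Suc (Suc n))
      = (\<lambda>x. x * hermite_poly (Suc n) x - real (Suc n) * hermite_poly n x)"
    by (simp add: fun_eq_iff)
  ultimately show ?case
    by (simp add: hermite_poly_Suc[of n] algebra_simps)
qed (auto intro!: derivative_eq_intros simp: hermite_poly.simps[abs_def])

text \<open>Hermite's differential equation \<open>H'' = x H' - n H\<close>, with \<open>H'\<close>
  already replaced by its value.\<close>

lemma hermite_poly_second_deriv:
  "((\<lambda>x. real n * hermite_poly (n - 1) x) has_real_derivative
     x * (real n * hermite_poly (n - 1) x) - real n * hermite_poly n x) (at x)"
proof (cases n)
  case (Suc m)
  have "((\<lambda>x. real n * hermite_poly m x) has_real_derivative
      real n * (real m * hermite_poly (m - 1) x)) (at x)"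
    by (rule derivative_eq_intros hermite_poly_deriv refl | simp)+
  then show ?thesis
    by (simp add: Suc hermite_poly_Suc[of m] algebra_simps)
qed simp

section \<open>Identification with the derivatives of the normal density\<close>

lemma std_normal_density_deriv:
  "(std_normal_density has_real_derivative - x * std_normal_density x) (at x)"
  unfolding std_normal_density_def
  by (auto intro!: derivative_eq_intros simp: field_simps)

lemma std_normal_density_iterated_deriv:
  "(deriv ^^ n) std_normal_density = (\<lambda>x. (- 1) ^ n * hermite_poly n x * std_normal_density x)"
proof (induction n)
  case (Suc n)
  have "((\<lambda>x. (- 1) ^ n * hermite_poly n x * std_normal_density x) has_real_derivative
      (- 1) ^ Suc n * hermite_poly (Suc n) x * std_normal_density x) (at x)" for x
    by (rule derivative_eq_intros hermite_poly_deriv std_normal_density_deriv refl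
        | simp add: hermite_poly_Suc algebra_simps)+
  then show ?case
    by (simp add: Suc DERIV_imp_deriv fun_eq_iff)
qed simp

lemma Hermite_eq: "Hermite n = hermite_poly n"
proof
  fix x
  have "std_normal_density x > 0"
    by (rule normal_density_pos) simp
  then show "Hermite n x = hermite_poly n x"
    by (simp add: Hermite_def std_normal_density_iterated_deriv flip: power_mult_distrib)
qed

section \<open>Parity, decay at infinity and values at the origin\<close>

lemma hermite_poly_minus: "hermite_poly n (- x) = (- 1) ^ n * hermite_poly n x"
  by (induction n x rule: hermite_poly.induct) (auto simp: algebra_simps)

text \<open>The power \<open>x ^ k\<close> strengthens the induction, since the recurrence
  multiplies by \<open>x\<close>.\<close>

lemma hermite_poly_times_gaussian_tendsto_0:
  "((\<lambda>x. x ^ k * hermite_poly n x * exp (- x\<^sup>2 / 4)) \<longlongrightarrow> 0) at_top"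
proof (induction n arbitrary: k rule: less_induct)
  case (less n)
  show ?case
  proof (cases n)
    case 0
    have "((\<lambda>x::real. x ^ k * exp (- x\<^sup>2 / 4)) \<longlongrightarrow> 0) at_top"
      by real_asymp
    then show ?thesis
      by (simp add: 0)
  next
    case (Suc m)
    have "((\<lambda>x. x ^ Suc k * hermite_poly m x * exp (- x\<^sup>2 / 4)
        - real m * (x ^ k * hermite_poly (m - 1) x * exp (- x\<^sup>2 / 4))) \<longlongrightarrow> 0 - real m * 0) at_top"
      by (intro tendsto_intros less) (auto simp: Suc)
    then show ?thesis
      by (simp add: Suc hermite_poly_Suc[of m] algebra_simps)
  qed
qed

text \<open>At 0 the recurrence skips one index, so the left side gains the factor
  \<open>(n + 1) / (n + 2)\<close> every two steps.\<close>

lemma hermite_poly_at_0_bound: "(hermite_poly n 0)\<^sup>2 / fact n \<le> 1 / sqrt (real n + 1)"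
proof (induction n rule: induct_nat_012)
  case (ge2 n)
  have "(hermite_poly (Suc (Suc n)) 0)\<^sup>2 / fact (Suc (Suc n))
      = (real n + 1) / (real n + 2) * ((hermite_poly n 0)\<^sup>2 / fact n)"
    by (simp add: power_mult_distrib power2_eq_square divide_simps) (simp add: algebra_simps)
  also have "\<dots> \<le> (real n + 1) / (real n + 2) * (1 / sqrt (real n + 1))"
    using ge2 by (intro mult_left_mono) auto
  also have "\<dots> = sqrt (real n + 1) / (real n + 2)"
    by (simp add: divide_simps flip: power2_eq_square)
  also have "\<dots> \<le> 1 / sqrt (real n + 3)"
  proof -
    \<comment> \<open>The induction closes because
      \<open>(n + 1) * (n + 3) <= (n + 2)^2\<close>.\<close>
    have "sqrt (real n + 1) * sqrt (real n + 3) = sqrt ((real n + 1) * (real n + 3))"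
      by (simp add: real_sqrt_mult)
    also have "\<dots> \<le> real n + 2"
      by (rule real_le_lsqrt) (auto simp: power2_eq_square algebra_simps)
    finally show ?thesis
      by (simp add: field_simps)
  qed
  finally show ?case
    by (simp add: add.commute)
qed auto

section \<open>The estimate for Hermite functions and the theorem\<close>

lemma hermite_function_bound:
  assumes "n \<ge> 1" and "y \<ge> 0"
  shows "\<bar>hermite_poly n y * exp (- y\<^sup>2 / 4)\<bar> \<le> 9 * sqrt (fact n) * real n powr (- (1 / 12))"
proof -
  define t where "t = (real n + 1 / 2) powr (1 / 6)"
  \<comment> \<open>This normalisation keeps the initial energy bounded by 2, uniformly in
    \<open>n\<close>: position and velocity at 0 contribute at most 1 each.\<close>
  define c where "c = 1 / sqrt (fact n :: real)"
  define u where "u = (\<lambda>y. c * (hermite_poly n y * exp (- y\<^sup>2 / 4)))"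
  define v where "v = (\<lambda>y. c * ((real n * hermite_poly (n - 1) y - y / 2 * hermite_poly n y)
    * exp (- y\<^sup>2 / 4)))"
  have t6: "t ^ 6 = real n + 1 / 2"
    by (simp add: t_def powr_power)
  have t3: "t ^ 3 = sqrt (real n + 1 / 2)"
    by (simp add: t_def powr_power powr_half_sqrt)
  interpret weber_solution t u v
  proof
    show "t \<ge> 1"
      using assms by (auto simp: t_def intro!: ge_one_powr_ge_zero)
    fix y
    show "(u has_real_derivative v y) (at y)"
      unfolding u_def v_def
      by (rule derivative_eq_intros hermite_poly_deriv refl | simp add: algebra_simps)+
    show "(v has_real_derivative - ((t ^ 6 - y\<^sup>2 / 4) * u y)) (at y)"
      unfolding u_def v_def t6
      by (rule derivative_eq_intros hermite_poly_deriv hermite_poly_second_deriv refl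
          | simp add: field_simps power2_eq_square)+
  qed
  have "(u \<longlongrightarrow> 0) at_top"
    unfolding u_def
    using tendsto_mult_left[OF hermite_poly_times_gaussian_tendsto_0[of 0 n], of c] by simp
  moreover have "t ^ 3 * (u 0)\<^sup>2 + (v 0)\<^sup>2 / t ^ 3 \<le> 2"
  proof -
    obtain m where m: "n = Suc m"
      using assms by (cases n) auto
    have "(u 0)\<^sup>2 = (hermite_poly n 0)\<^sup>2 / fact n"
      by (simp add: u_def c_def power_mult_distrib power_divide)
    also have "\<dots> \<le> 1 / sqrt (real n + 1)"
      by (rule hermite_poly_at_0_bound)
    also have "\<dots> \<le> 1 / t ^ 3"
      unfolding t3 by (simp add: frac_le)
    finally have u0: "t ^ 3 * (u 0)\<^sup>2 \<le> 1"
      using t_ge_1 by (simp add: field_simps)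
    \<comment> \<open>Absorbing one factor \<open>n\<close> into the factorial leaves the quantity
      bounded by \<open>hermite_poly_at_0_bound\<close> at index \<open>n - 1\<close>.\<close>
    have "(v 0)\<^sup>2 = real n * ((hermite_poly m 0)\<^sup>2 / fact m)"
    proof -
      have "fact n = real n * fact m"
        by (simp add: m)
      then have "(v 0)\<^sup>2 = (real n * hermite_poly m 0)\<^sup>2 / (real n * fact m)"
        by (simp add: v_def c_def m power_mult_distrib power_divide)
      then show ?thesis
        using assms by (simp add: power2_eq_square)
    qed
    moreover have "(hermite_poly m 0)\<^sup>2 / fact m \<le> 1 / sqrt (real n)"
      using hermite_poly_at_0_bound[of m] by (simp add: m add.commute)
    ultimately have "(v 0)\<^sup>2 \<le> real n * (1 / sqrt (real n))"
      by (simp only: mult_left_mono of_nat_0_le_iff)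
    then have "(v 0)\<^sup>2 \<le> sqrt (real n)"
      by (simp add: real_div_sqrt)
    then have "(v 0)\<^sup>2 \<le> t ^ 3"
      unfolding t3 by (rule order_trans) simp
    then have "(v 0)\<^sup>2 / t ^ 3 \<le> 1"
      using t_ge_1 by simp
    with u0 show ?thesis by linarith
  qed
  ultimately have "(u y)\<^sup>2 \<le> 36 * 2 / t"
    using square_le assms by blast
  \<comment> \<open>Rounding 72 up to a perfect square yields the constant 9 after the square
    root.\<close>
  also have "\<dots> \<le> 81 / t"
    using t_ge_1 by (simp add: divide_right_mono)
  also have "\<dots> \<le> 81 * real n powr (- (1 / 6))"
    using assms unfolding t_def
    by (simp add: powr_minus_divide) (intro divide_left_mono powr_mono2 mult_pos_pos; simp)
  also have "\<dots> = (9 * real n powr (- (1 / 12)))\<^sup>2"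
    by (simp add: power2_eq_square flip: powr_add)
  finally have "\<bar>u y\<bar> \<le> 9 * real n powr (- (1 / 12))"
    by (intro power2_le_imp_le[of "\<bar>u y\<bar>"]) simp_all
  moreover have "\<bar>u y\<bar> = \<bar>hermite_poly n y * exp (- y\<^sup>2 / 4)\<bar> / sqrt (fact n)"
    by (simp add: u_def c_def abs_mult)
  ultimately show ?thesis
    by (simp only: pos_divide_le_eq real_sqrt_gt_zero fact_gt_zero mult_ac)
qed

theorem lemma1:
  shows "\<exists>K\<^sub>0::real. K\<^sub>0 > 0 \<and>
    (\<forall>(n::nat) (y::real). n \<ge> 1 \<longrightarrow>
      \<bar>exp (- y\<^sup>2 / 2) * Hermite n y\<bar>
        \<le> K\<^sub>0 * sqrt (fact n) * real n powr (- (1 / 12)) * exp (- y\<^sup>2 / 4))"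
proof (intro exI[of _ 9] conjI allI impI)
  fix n :: nat and y :: real
  assume n: "n \<ge> 1"
  \<comment> \<open>Parity reduces the claim to \<open>y >= 0\<close>.\<close>
  have "\<bar>hermite_poly n y\<bar> = \<bar>hermite_poly n \<bar>y\<bar>\<bar>"
    by (cases "y \<ge> 0") (simp_all add: hermite_poly_minus abs_mult power_abs)
  then have "\<bar>hermite_poly n y * exp (- y\<^sup>2 / 4)\<bar> \<le> 9 * sqrt (fact n) * real n powr (- (1 / 12))"
    using hermite_function_bound[OF n, of "\<bar>y\<bar>"] by (simp add: abs_mult)
  then have "\<bar>hermite_poly n y * exp (- y\<^sup>2 / 4)\<bar> * exp (- y\<^sup>2 / 4)
      \<le> 9 * sqrt (fact n) * real n powr (- (1 / 12)) * exp (- y\<^sup>2 / 4)"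
    by (rule mult_right_mono) simp
  \<comment> \<open>One Gaussian factor belongs to the Hermite function; the other is the one on the
    right-hand side.\<close>
  moreover have "exp (- y\<^sup>2 / 2) = exp (- y\<^sup>2 / 4) * exp (- y\<^sup>2 / 4)"
    by (simp flip: exp_add)
  ultimately show "\<bar>exp (- y\<^sup>2 / 2) * Hermite n y\<bar>
      \<le> 9 * sqrt (fact n) * real n powr (- (1 / 12)) * exp (- y\<^sup>2 / 4)"
    by (simp add: Hermite_eq abs_mult mult_ac)
qed simp

end
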